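(* Let $k$ and $r$ be positive integers with $k>r$, $\gcd(2k,r)\in\{1,2\}$ and $\gcd(2k,k-r)=1$. Let $s,t,i,j$ be integers with $s+t=S>0$, $s-t=D$, $i+j=S_3>0$, $i-j=D_3$ and $S=r(k-r)S_3$. Let $\epsilon=\pm1$ and $\delta=\frac{1-\epsilon}{2}$. Then for every complex $q$ with $0<|q|<1$, $$\begin{aligned} f(q^s,q^t)\,f(\epsilon q^i,\epsilon q^j)=&\sum_{\alpha=\left[\frac{2-k}{2}\right]}^{\left[\frac{k}{2}\right]}(-1)^{\alpha\delta}q^{\alpha(\alpha S_3+D_3)/2}\\ &\times f_{r\delta}\!\left(q^{(r(S_3(k+2\alpha)+D_3)+D)/2},\,q^{(r(S_3(k-2\alpha)-D_3)-D)/2}\right)\\ &\times f_{\delta}\!\left(q^{((k-r)(S_3(k-2\alpha)-D_3)+D)/2},\,q^{((k-r)(S_3(k+2\alpha)+D_3)-D)/2}\right). \end{aligned}$$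
   Context: Ramanujan's general theta function is $f(a,b)=\sum_{n=-\infty}^{\infty}a^{n(n+1)/2}b^{n(n-1)/2}$ for $|ab|<1$. For an integer $\delta$, $f_\delta(a,b)=f(a,b)$ if $\delta\equiv0\pmod 2$ and $f_\delta(a,b)=f(-a,-b)$ if $\delta\equiv1\pmod2$. $[x]$ denotes the greatest integer less than or equal to $x$. *)

theory Defs
  imports "HOL-Analysis.Analysis"
begin

text \<open>Ramanujan's general theta function, meaningful for \<open>norm (a * b) < 1\<close>. Both exponents are
  non-negative integers and the divisions by 2 are exact.\<close>

definition ramanujan_theta :: "complex \<Rightarrow> complex \<Rightarrow> complex" where
  "ramanujan_theta a b =
     (\<Sum>\<^sub>\<infinity>n\<in>(UNIV :: int set). a powi (n * (n + 1) div 2) * b powi (n * (n - 1) div 2))"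

definition ramanujan_theta_sgn :: "int \<Rightarrow> complex \<Rightarrow> complex \<Rightarrow> complex" where
  "ramanujan_theta_sgn \<delta> a b =
     (if even \<delta> then ramanujan_theta a b else ramanujan_theta (- a) (- b))"

text \<open>Powers of \<open>q\<close> with exponent \<open>x/2\<close> are written \<open>q powi (x div 2)\<close>, so no branch of the square
  root is involved. The following facts show that the halved quantities are even integers under the
  hypotheses used, i.e. that \<open>div 2\<close> is exact division.\<close>

lemma even_exponent_monomial:
  fixes i j \<alpha> :: int
  shows "even (\<alpha> * (\<alpha> * (i + j) + (i - j)))"
  by auto

lemma even_exponent_theta:
  fixes k r s t i j \<alpha> :: int
  assumes "s + t = r * (k - r) * (i + j)" and "gcd (2 * k) (k - r) = 1"
  shows "even (r * ((i + j) * (k + 2 * \<alpha>) + (i - j)) + (s - t))"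
    and "even (r * ((i + j) * (k - 2 * \<alpha>) - (i - j)) - (s - t))"
    and "even ((k - r) * ((i + j) * (k - 2 * \<alpha>) - (i - j)) + (s - t))"
    and "even ((k - r) * ((i + j) * (k + 2 * \<alpha>) + (i - j)) - (s - t))"
proof -
  have odd: "odd (k - r)"
    using assms(2) by (metis dvd_triv_left gcd_greatest odd_one)
  have "even (s + t) \<longleftrightarrow> even (r * (k - r) * (i + j))"
    using assms(1) by simp
  then have st: "even (s - t) \<longleftrightarrow> even (r * (i + j))"
    using odd by auto
  show "even (r * ((i + j) * (k + 2 * \<alpha>) + (i - j)) + (s - t))"
    and "even (r * ((i + j) * (k - 2 * \<alpha>) - (i - j)) - (s - t))"
    and "even ((k - r) * ((i + j) * (k - 2 * \<alpha>) - (i - j)) + (s - t))"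
    and "even ((k - r) * ((i + j) * (k + 2 * \<alpha>) + (i - j)) - (s - t))"
    using odd st by auto
qed

end

theory Submission
  imports Defs
begin

text \<open>Both sides are the double series over \<open>\<int>\<^sup>2\<close> of
  \<open>\<epsilon>\<^sup>n q\<close> to the power \<open>(S m\<^sup>2 + D m + S\<^sub>3 n\<^sup>2 + D\<^sub>3 n) / 2\<close>, rearranged by the substitution
  \<open>m = u + v\<close>, \<open>n = \<alpha> + r u - (k - r) v\<close>. Since \<open>S = r (k - r) S\<^sub>3\<close>, the mixed term in \<open>u v\<close>
  cancels, so the series factors for each \<open>\<alpha>\<close>; and since \<open>n - r m = \<alpha> - k v\<close>, every pair \<open>(m, n)\<close>
  is hit exactly once when \<open>\<alpha>\<close> runs through \<open>k\<close> consecutive integers.\<close>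

text \<open>The exponent of \<open>q\<close> in the \<open>n\<close>-th term of
  \<open>f(q^a, q^b)\<close>, that is \<open>((a + b) n^2 + (a - b) n) / 2\<close>. Halving the two
  products of consecutive integers separately keeps every division exact, whatever the parity of
  \<open>a\<close> and \<open>b\<close>.\<close>

definition theta_exponent :: "int \<Rightarrow> int \<Rightarrow> int \<Rightarrow> int" where
  "theta_exponent a b n = a * (n * (n + 1) div 2) + b * (n * (n - 1) div 2)"

lemma two_theta_exponent: "2 * theta_exponent a b n = a * (n * (n + 1)) + b * (n * (n - 1))"
proof -
  have "2 * (n * (n + 1) div 2) = n * (n + 1)" "2 * (n * (n - 1) div 2) = n * (n - 1)"
    by simp_all
  then show ?thesis
    unfolding theta_exponent_def by algebra
qed

text \<open>The two triangular exponents differ by \<open>n\<close>, so their sum has the parity of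
  \<open>n\<close> and a common sign \<open>c\<close> of both arguments contributes
  \<open>c powi n\<close>.\<close>

lemma ramanujan_theta_powi:
  fixes q c :: complex
  assumes "q \<noteq> 0" and c: "c = 1 \<or> c = -1"
  shows "ramanujan_theta (c * q powi a) (c * q powi b) =
    (\<Sum>\<^sub>\<infinity>n\<in>UNIV. c powi n * q powi theta_exponent a b n)"
  unfolding ramanujan_theta_def
proof (rule infsum_cong)
  fix n :: int
  define x y where "x = n * (n + 1) div 2" and "y = n * (n - 1) div 2"
  have "2 * x = n * (n + 1)" "2 * y = n * (n - 1)"
    unfolding x_def y_def by simp_all
  then have "x = y + n"
    by algebra
  then have "c powi (x + y) = c powi n"
    using c by (auto simp: power_int_minus_left)
  moreover have "c \<noteq> 0"
    using c by auto
  ultimately have "c powi x * c powi y = c powi n"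
    by (simp add: power_int_add)
  then show "(c * q powi a) powi (n * (n + 1) div 2) * (c * q powi b) powi (n * (n - 1) div 2) =
      c powi n * q powi theta_exponent a b n"
    using \<open>q \<noteq> 0\<close> unfolding theta_exponent_def x_def [symmetric] y_def [symmetric]
    by (simp add: power_int_mult_distrib power_int_mult power_int_add mult_ac)
qed

text \<open>Turns the parity case distinction into a sign factor, the form in which
  \<open>ramanujan_theta_powi\<close> applies.\<close>

lemma ramanujan_theta_sgn_eq:
  "ramanujan_theta_sgn d x y = ramanujan_theta ((-1) powi d * x) ((-1) powi d * y)"
  by (simp add: ramanujan_theta_sgn_def power_int_minus_left)

lemma summable_on_power_nat_abs:
  fixes x :: real
  assumes "0 \<le> x" "x < 1"
  shows "(\<lambda>n::int. x ^ nat \<bar>n\<bar>) summable_on UNIV"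
proof -
  have geometric: "(\<lambda>n. x ^ n) summable_on (UNIV :: nat set)"
    using assms by (intro norm_summable_imp_summable_on) (simp add: summable_geometric)
  have "(\<lambda>n. x ^ nat \<bar>n\<bar>) summable_on range int"
    using geometric by (subst summable_on_reindex) (auto simp: o_def)
  moreover have "(\<lambda>n. x ^ nat \<bar>n\<bar>) summable_on range (\<lambda>n. - int n)"
    using geometric by (subst summable_on_reindex) (auto simp: o_def inj_on_def)
  ultimately have "(\<lambda>n. x ^ nat \<bar>n\<bar>) summable_on (range int \<union> range (\<lambda>n. - int n))"
    by (rule summable_on_union)
  moreover have "range int \<union> range (\<lambda>n. - int n) = UNIV"
    by (auto simp: image_iff) (metis int_cases2)
  ultimately show ?thesis
    by simp
qed

text \<open>The quadratic term dominates the linear one. A lower bound linear in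
  \<open>\<bar>n\<bar>\<close> is what a comparison with a geometric series requires.\<close>

lemma theta_exponent_ge:
  assumes "a + b > 0"
  shows "\<bar>n\<bar> - (\<bar>a - b\<bar> + 2)\<^sup>2 \<le> theta_exponent a b n"
proof -
  define d where "d = \<bar>a - b\<bar>"
  have "2 * theta_exponent a b n = (a + b) * n\<^sup>2 + (a - b) * n"
    by (simp add: two_theta_exponent power2_eq_square algebra_simps)
  moreover have "(a + b) * n\<^sup>2 \<ge> \<bar>n\<bar>\<^sup>2"
    using assms mult_right_mono [of 1 "a + b" "n\<^sup>2"] by simp
  moreover have "(a - b) * n \<ge> - (d * \<bar>n\<bar>)"
    unfolding d_def by (metis abs_ge_minus_self abs_mult minus_le_iff)
  \<comment> \<open>Completing the square gives even \<open>- (d + 2)^2 / 4\<close> as lower bound.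
    The 2 added to \<open>d\<close> reserves \<open>2 * \<bar>n\<bar>\<close>, which becomes
    \<open>\<bar>n\<bar>\<close> once the doubled exponent is halved.\<close>
  moreover have "\<bar>n\<bar>\<^sup>2 - (d + 2) * \<bar>n\<bar> \<ge> - 2 * (d + 2)\<^sup>2"
    using zero_le_power2 [of "2 * \<bar>n\<bar> - (d + 2)"] zero_le_power2 [of "d + 2"]
    unfolding power2_eq_square by (simp only: algebra_simps)
  ultimately show ?thesis
    unfolding d_def by (simp add: algebra_simps)
qed

lemma abs_summable_theta:
  fixes q c :: complex
  assumes "a + b > 0" "0 < norm q" "norm q < 1" "norm c = 1"
  shows "(\<lambda>n. norm (c powi n * q powi theta_exponent a b n)) summable_on UNIV"
proof (rule Infinite_Sum.abs_summable_on_comparison_test')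
  define N where "N = (\<bar>a - b\<bar> + 2)\<^sup>2"
  show "(\<lambda>n. norm q ^ nat \<bar>n\<bar> * norm q powi (- N)) summable_on UNIV"
    using assms by (intro summable_on_cmult_left summable_on_power_nat_abs) auto
  fix n :: int
  have "norm (c powi n * q powi theta_exponent a b n) = norm q powi theta_exponent a b n"
    using assms by (simp add: norm_mult norm_power_int)
  also have "\<dots> \<le> norm q powi (\<bar>n\<bar> + - N)"
    using assms theta_exponent_ge [of a b n] by (intro power_int_decreasing) (auto simp: N_def)
  also have "\<dots> = norm q ^ nat \<bar>n\<bar> * norm q powi (- N)"
    using assms by (subst power_int_add) (auto simp: power_int_nonneg_exp)
  finally show "norm (c powi n * q powi theta_exponent a b n) \<le> norm q ^ nat \<bar>n\<bar> * norm q powi (- N)" .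
qed

lemma abs_summable_on_times:
  fixes f g :: "_ \<Rightarrow> 'a :: {real_normed_field, banach}"
  assumes "(\<lambda>x. norm (f x)) summable_on A" "(\<lambda>y. norm (g y)) summable_on B"
  shows "(\<lambda>p. norm (case p of (x, y) \<Rightarrow> f x * g y)) summable_on A \<times> B"
  unfolding Infinite_Sum.abs_summable_on_Sigma_iff
  using assms
  by (auto simp: norm_mult infsum_cmult_right' summable_on_cmult_left' abs_mult infsum_nonneg
      intro!: summable_on_cmult_right summable_on_cmult_left)

lemma infsum_times:
  fixes f g :: "_ \<Rightarrow> 'a :: {real_normed_field, banach}"
  assumes "(\<lambda>(x, y). f x * g y) summable_on A \<times> B"
  shows "infsum f A * infsum g B = (\<Sum>\<^sub>\<infinity>(x, y)\<in>A \<times> B. f x * g y)"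
  by (simp add: infsum_Sigma'_banach [OF assms, symmetric] infsum_cmult_left' infsum_cmult_right')

text \<open>Division with remainder: \<open>n - r * m = \<alpha> - k * v\<close>, so
  \<open>\<alpha>\<close> is the representative of \<open>n - r * m\<close> modulo \<open>k\<close>
  in the window starting at \<open>l\<close>.\<close>

lemma bij_betw_residues:
  fixes k r l :: int
  assumes "k > 0"
  shows "bij_betw (\<lambda>(\<alpha>, u, v). (u + v, \<alpha> + r * u - (k - r) * v)) ({l..<l + k} \<times> UNIV) UNIV"
\<comment> \<open>Here \<open>d = (\<alpha> - l) - k * v\<close> with
  \<open>0 \<le> \<alpha> - l < k\<close>; remainder and quotient of \<open>d\<close> by
  \<open>k\<close> are therefore \<open>\<alpha> - l\<close> and \<open>- v\<close>, and then
  \<open>u = m - v\<close>.\<close>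
proof (rule bij_betw_byWitness [where f' = "\<lambda>(m, n). let d = n - r * m - l in
    (l + d mod k, m + d div k, - (d div k))"])
  have "(\<alpha> + r * u - (k - r) * v - r * (u + v) - l) div k = - v \<and>
      (\<alpha> + r * u - (k - r) * v - r * (u + v) - l) mod k = \<alpha> - l" if "l \<le> \<alpha>" "\<alpha> < l + k" for \<alpha> u v
  proof -
    have "\<alpha> + r * u - (k - r) * v - r * (u + v) - l = (\<alpha> - l) + k * (- v)"
      by algebra
    moreover have "((\<alpha> - l) + k * (- v)) div k = - v" "((\<alpha> - l) + k * (- v)) mod k = \<alpha> - l"
      using that assms div_mult_self2 [of k "\<alpha> - l" "- v"] mod_mult_self2 [of "\<alpha> - l" k "- v"]
      by (simp_all del: div_mult_self2 mod_mult_self2)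
    ultimately show ?thesis
      by (simp only:)
  qed
  then show "\<forall>p\<in>{l..<l + k} \<times> UNIV. (\<lambda>(m, n). let d = n - r * m - l in
      (l + d mod k, m + d div k, - (d div k)))
      ((\<lambda>(\<alpha>, u, v). (u + v, \<alpha> + r * u - (k - r) * v)) p) = p"
    by (simp add: Let_def)
next
  have "l + d mod k + r * (m + d div k) - (k - r) * - (d div k) = n"
    if "d = n - r * m - l" for d m n
    using mult_div_mod_eq [of k d] that by (simp add: algebra_simps del: mult_div_mod_eq)
  then show "\<forall>p\<in>UNIV. (\<lambda>(\<alpha>, u, v). (u + v, \<alpha> + r * u - (k - r) * v))
      ((\<lambda>(m, n). let d = n - r * m - l in (l + d mod k, m + d div k, - (d div k))) p) = p"
    by (simp add: Let_def)
qed (use assms in \<open>auto simp: Let_def\<close>)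

theorem theorem4p1:
  fixes k r s t i j S D S\<^sub>3 D\<^sub>3 \<epsilon> \<delta> :: int and q :: complex
  assumes "k > 0" and "r > 0" and "k > r"
    and "gcd (2 * k) r \<in> {1, 2}" and "gcd (2 * k) (k - r) = 1"
    and "s + t = S" and "S > 0" and "s - t = D"
    and "i + j = S\<^sub>3" and "S\<^sub>3 > 0" and "i - j = D\<^sub>3"
    and "S = r * (k - r) * S\<^sub>3"
    and "\<epsilon> = 1 \<or> \<epsilon> = -1" and "\<delta> = (1 - \<epsilon>) div 2"
    and "0 < norm q" and "norm q < 1"
  shows "ramanujan_theta (q powi s) (q powi t) *
           ramanujan_theta (of_int \<epsilon> * q powi i) (of_int \<epsilon> * q powi j) =
         (\<Sum>\<alpha> = \<lfloor>(2 - real_of_int k) / 2\<rfloor>..\<lfloor>real_of_int k / 2\<rfloor>.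
            (-1) powi (\<alpha> * \<delta>) * q powi (\<alpha> * (\<alpha> * S\<^sub>3 + D\<^sub>3) div 2) *
            ramanujan_theta_sgn (r * \<delta>)
              (q powi ((r * (S\<^sub>3 * (k + 2 * \<alpha>) + D\<^sub>3) + D) div 2))
              (q powi ((r * (S\<^sub>3 * (k - 2 * \<alpha>) - D\<^sub>3) - D) div 2)) *
            ramanujan_theta_sgn \<delta>
              (q powi (((k - r) * (S\<^sub>3 * (k - 2 * \<alpha>) - D\<^sub>3) + D) div 2))
              (q powi (((k - r) * (S\<^sub>3 * (k + 2 * \<alpha>) + D\<^sub>3) - D) div 2)))"
proof -
  define c where "c = ((-1) powi \<delta> :: complex)"
  define c' where "c' = ((-1) powi (r * \<delta>) :: complex)"
  define l where "l = (2 - k) div 2"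
  \<comment> \<open>The trivial factor \<open>1 powi m\<close> gives both theta series the same
    shape, with signs \<open>1\<close> and \<open>c\<close>, where \<open>c\<close> equals
    \<epsilon>.\<close>
  define F where "F = (\<lambda>m n. (1 powi m * q powi theta_exponent s t m) * (c powi n * q powi theta_exponent i j n))"
  define A B A' B' M where
    "A = (\<lambda>\<alpha>. (r * (S\<^sub>3 * (k + 2 * \<alpha>) + D\<^sub>3) + D) div 2)" and
    "B = (\<lambda>\<alpha>. (r * (S\<^sub>3 * (k - 2 * \<alpha>) - D\<^sub>3) - D) div 2)" and
    "A' = (\<lambda>\<alpha>. ((k - r) * (S\<^sub>3 * (k - 2 * \<alpha>) - D\<^sub>3) + D) div 2)" and
    "B' = (\<lambda>\<alpha>. ((k - r) * (S\<^sub>3 * (k + 2 * \<alpha>) + D\<^sub>3) - D) div 2)" and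
    "M = (\<lambda>\<alpha>. \<alpha> * (\<alpha> * S\<^sub>3 + D\<^sub>3) div 2)"
  define G where "G = (\<lambda>\<alpha> u v. (-1) powi (\<alpha> * \<delta>) * q powi M \<alpha> *
    (c' powi u * q powi theta_exponent (A \<alpha>) (B \<alpha>) u) *
    (c powi v * q powi theta_exponent (A' \<alpha>) (B' \<alpha>) v))"
  have q: "q \<noteq> 0" and c: "c = 1 \<or> c = -1" "norm c = 1" and c': "c' = 1 \<or> c' = -1"
    using assms by (auto simp: c_def c'_def power_int_minus_left)
  have \<epsilon>: "of_int \<epsilon> = c"
    using assms by (auto simp: c_def)
  have S: "s + t = r * (k - r) * (i + j)"
    using assms by simp
  have odd: "odd (k - r)"
    using assms(5) by (metis dvd_triv_left gcd_greatest odd_one)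
  \<comment> \<open>All halvings are exact because \<open>k - r\<close> is odd and
    \<open>s + t = r * (k - r) * (i + j)\<close>; the doubled values make the exponent identity
    polynomial.\<close>
  have doubled:
    "2 * A \<alpha> = r * (S\<^sub>3 * (k + 2 * \<alpha>) + D\<^sub>3) + D"
    "2 * B \<alpha> = r * (S\<^sub>3 * (k - 2 * \<alpha>) - D\<^sub>3) - D"
    "2 * A' \<alpha> = (k - r) * (S\<^sub>3 * (k - 2 * \<alpha>) - D\<^sub>3) + D"
    "2 * B' \<alpha> = (k - r) * (S\<^sub>3 * (k + 2 * \<alpha>) + D\<^sub>3) - D"
    "2 * M \<alpha> = \<alpha> * (\<alpha> * S\<^sub>3 + D\<^sub>3)" for \<alpha>
    using even_exponent_theta [of s t r k i j \<alpha>] even_exponent_monomial [of \<alpha> i j] S assms(5)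
    unfolding A_def B_def A'_def B'_def M_def assms(6,8,9,11)[symmetric]
    by (simp_all only: dvd_mult_div_cancel)
  have G: "G \<alpha> u v = F (u + v) (\<alpha> + r * u - (k - r) * v)" for \<alpha> u v
  proof -
    define n where "n = \<alpha> + r * u - (k - r) * v"
    have "(-1) powi (\<alpha> * \<delta>) * c' powi u * c powi v = (-1) powi (\<delta> * (\<alpha> + r * u + v))"
      unfolding c_def c'_def
      by (simp add: power_int_mult [symmetric] power_int_add [symmetric] algebra_simps)
    \<comment> \<open>The difference \<open>\<alpha> + r * u + v - n = (k - r + 1) * v\<close> is
      even, as \<open>k - r\<close> is odd.\<close>
    also have "\<dots> = (-1) powi (\<delta> * n)"
      using odd by (simp add: power_int_minus_left n_def)
    also have "\<dots> = c powi n"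
      by (simp add: c_def power_int_mult)
    finally have sign: "(-1) powi (\<alpha> * \<delta>) * c' powi u * c powi v = c powi n" .
    \<comment> \<open>The factor 4 clears two halvings: one inside \<open>A\<close>,
      \<open>B\<close>, \<open>A'\<close>, \<open>B'\<close> and one in
      \<open>theta_exponent\<close>.\<close>
    have "4 * (M \<alpha> + theta_exponent (A \<alpha>) (B \<alpha>) u + theta_exponent (A' \<alpha>) (B' \<alpha>) v) =
        2 * (2 * M \<alpha>) + (2 * A \<alpha>) * (u * (u + 1)) + (2 * B \<alpha>) * (u * (u - 1)) +
        (2 * A' \<alpha>) * (v * (v + 1)) + (2 * B' \<alpha>) * (v * (v - 1))"
      using two_theta_exponent [of "A \<alpha>" "B \<alpha>" u] two_theta_exponent [of "A' \<alpha>" "B' \<alpha>" v]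
      by algebra
    \<comment> \<open>The coefficient of \<open>u * v\<close> is proportional to
      \<open>(s + t) - r * (k - r) * (i + j)\<close> and vanishes by \<open>S\<close>.\<close>
    also have "\<dots> = 2 * (s * ((u + v) * (u + v + 1)) + t * ((u + v) * (u + v - 1)) +
        i * (n * (n + 1)) + j * (n * (n - 1)))"
      unfolding doubled n_def assms(6,8,9,11)[symmetric] using S by algebra
    also have "\<dots> = 4 * (theta_exponent s t (u + v) + theta_exponent i j n)"
      using two_theta_exponent [of s t "u + v"] two_theta_exponent [of i j n] by algebra
    finally have expo: "M \<alpha> + theta_exponent (A \<alpha>) (B \<alpha>) u + theta_exponent (A' \<alpha>) (B' \<alpha>) v =
        theta_exponent s t (u + v) + theta_exponent i j n"
      by simp
    have "G \<alpha> u v = ((-1) powi (\<alpha> * \<delta>) * c' powi u * c powi v) *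
        q powi (M \<alpha> + theta_exponent (A \<alpha>) (B \<alpha>) u + theta_exponent (A' \<alpha>) (B' \<alpha>) v)"
      using q by (simp add: G_def power_int_add)
    also have "\<dots> = F (u + v) n"
      unfolding sign expo F_def using q by (simp add: power_int_add)
    finally show ?thesis
      by (simp add: n_def)
  qed
  have "(\<lambda>p. norm (case p of (m, n) \<Rightarrow> F m n)) summable_on UNIV \<times> UNIV"
    unfolding F_def using assms c by (intro abs_summable_on_times abs_summable_theta) auto
  then have F: "(\<lambda>(m, n). F m n) summable_on UNIV \<times> UNIV"
    by (rule abs_summable_summable)
  have bij: "bij_betw (\<lambda>(\<alpha>, u, v). (u + v, \<alpha> + r * u - (k - r) * v)) ({l..<l + k} \<times> UNIV) UNIV"
    using assms by (intro bij_betw_residues)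
  \<comment> \<open>Summability carried along the bijection justifies summing over
    \<open>(u, v)\<close> first and over \<alpha> last.\<close>
  have Gsum: "(\<lambda>(\<alpha>, p). case p of (u, v) \<Rightarrow> G \<alpha> u v) summable_on {l..<l + k} \<times> UNIV"
    using summable_on_reindex_bij_betw [OF bij, of "\<lambda>(m, n). F m n"] F
    by (simp add: G case_prod_unfold)
  have Gsum': "(\<lambda>(u, v). G \<alpha> u v) summable_on UNIV \<times> UNIV" if "\<alpha> \<in> {l..<l + k}" for \<alpha>
    using summable_on_SigmaD1 [OF Gsum that] by simp
  have inner: "(\<Sum>\<^sub>\<infinity>(u, v)\<in>UNIV. G \<alpha> u v) =
      (-1) powi (\<alpha> * \<delta>) * q powi M \<alpha> *
        ramanujan_theta_sgn (r * \<delta>) (q powi A \<alpha>) (q powi B \<alpha>) *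
        ramanujan_theta_sgn \<delta> (q powi A' \<alpha>) (q powi B' \<alpha>)" if "\<alpha> \<in> {l..<l + k}" for \<alpha>
  proof -
    \<comment> \<open>For fixed \<alpha> the term is a function of \<open>u\<close> times a function
      of \<open>v\<close>; the prefactor depending on \<alpha> is kept with the \<open>u\<close>
      series.\<close>
    have "(\<Sum>\<^sub>\<infinity>(u, v)\<in>UNIV. G \<alpha> u v) =
        (\<Sum>\<^sub>\<infinity>u\<in>UNIV. (-1) powi (\<alpha> * \<delta>) * q powi M \<alpha> *
          (c' powi u * q powi theta_exponent (A \<alpha>) (B \<alpha>) u)) *
        (\<Sum>\<^sub>\<infinity>v\<in>UNIV. c powi v * q powi theta_exponent (A' \<alpha>) (B' \<alpha>) v)"
      using infsum_times [OF Gsum' [OF that, unfolded G_def]] by (simp add: G_def)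
    also have "\<dots> = (-1) powi (\<alpha> * \<delta>) * q powi M \<alpha> *
        ramanujan_theta (c' * q powi A \<alpha>) (c' * q powi B \<alpha>) *
        ramanujan_theta (c * q powi A' \<alpha>) (c * q powi B' \<alpha>)"
      by (simp only: ramanujan_theta_powi [OF q c'] ramanujan_theta_powi [OF q c(1)]
          infsum_cmult_right')
    finally show ?thesis
      by (simp add: ramanujan_theta_sgn_eq c_def c'_def)
  qed
  have "ramanujan_theta (q powi s) (q powi t) *
      ramanujan_theta (of_int \<epsilon> * q powi i) (of_int \<epsilon> * q powi j) = (\<Sum>\<^sub>\<infinity>(m, n)\<in>UNIV. F m n)"
    using infsum_times [OF F [unfolded F_def]]
      ramanujan_theta_powi [OF q, of 1] ramanujan_theta_powi [OF q c(1)]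
    by (simp add: F_def \<epsilon>)
  also have "\<dots> = (\<Sum>\<^sub>\<infinity>(\<alpha>, p)\<in>{l..<l + k} \<times> UNIV. case p of (u, v) \<Rightarrow> G \<alpha> u v)"
    using infsum_reindex_bij_betw [OF bij, of "\<lambda>(m, n). F m n"]
    by (simp add: G case_prod_unfold)
  \<comment> \<open>Fubini; the outer index set is finite, so the outer infinite sum is a finite
    one.\<close>
  also have "\<dots> = (\<Sum>\<alpha>\<in>{l..<l + k}. \<Sum>\<^sub>\<infinity>(u, v)\<in>UNIV. G \<alpha> u v)"
    by (subst infsum_Sigma'_banach [OF Gsum, symmetric]) simp
  also have "\<dots> = (\<Sum>\<alpha>\<in>{l..<l + k}. (-1) powi (\<alpha> * \<delta>) * q powi M \<alpha> *
      ramanujan_theta_sgn (r * \<delta>) (q powi A \<alpha>) (q powi B \<alpha>) *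
      ramanujan_theta_sgn \<delta> (q powi A' \<alpha>) (q powi B' \<alpha>))"
    by (intro sum.cong refl inner)
  \<comment> \<open>For either parity of \<open>k\<close>, the integers from
    \<open>(2 - k) div 2\<close> to \<open>k div 2\<close> number exactly \<open>k\<close>, a
    complete residue system.\<close>
  also have "{l..<l + k} = {\<lfloor>(2 - real_of_int k) / 2\<rfloor>..\<lfloor>real_of_int k / 2\<rfloor>}"
  proof -
    have "\<lfloor>(2 - real_of_int k) / 2\<rfloor> = l"
      using floor_divide_of_int_eq [of "2 - k" 2, where ?'a = real] by (simp add: l_def)
    moreover have "\<lfloor>real_of_int k / 2\<rfloor> = k div 2"
      using floor_divide_of_int_eq [of k 2, where ?'a = real] by simp
    moreover have "k div 2 = l + k - 1"
      unfolding l_def by presburger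
    ultimately show ?thesis
      by auto
  qed
  finally show ?thesis
    by (simp only: A_def B_def A'_def B'_def M_def)
qed

end
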